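(* Let $\mathcal{D}$ be a finite dataset in $\mathbb{H}_r$, let $q\in\mathbb{H}_r$ be a query, and let $\mathcal{O}$ be an exact Euclidean nearest neighbor oracle with query time $\mathcal{T}$ and space $\mathcal{S}$. Suppose that the Euclidean nearest neighbor to $q$ in $\mathcal{D}$ is the $k$-th nearest hyperbolic neighbor to $q$ in $\mathcal{D}$. Then Recentering-HyperbolicNN returns the hyperbolic nearest neighbor of $q$ in $\mathcal{D}$ after at most $k+1$ invocations of $\mathcal{O}$. Its runtime is at most $(k+1)\mathcal{T}$ and its storage is $\mathcal{S}$.
   Context: $\mathbb{H}_r$ denotes the Poincaré ball model: the open unit ball of $\mathbb{R}^r$ with distance $d_H(x,y)=\operatorname{arccosh}\left(1+\frac{2\|x-y\|^2}{(1-\|x\|^2)(1-\|y\|^2)}\right)$, where $\|\cdot\|$ is the Euclidean norm. $\mathcal{B}_H(q,d)$ denotes the hyperbolic ball of center $q$ and hyperbolic radius $d$; it is a Euclidean ball with some Euclidean center $q'$ and Euclidean radius $d'$. An exact Euclidean nearest neighbor oracle $\mathcal{O}$ takes a point $q$ and the dataset $\mathcal{D}$ and returns $\mathcal{O}(q,\mathcal{D})$, an element of $\mathcal{D}$ minimizing Euclidean distance to $q$, in query time $\mathcal{T}$ using space $\mathcal{S}$. Recentering-HyperbolicNN is the following algorithm: set $n_H\leftarrow q$ and $n_E\leftarrow\mathcal{O}(q,\mathcal{D})$; while $d_H(n_E,q)\neq d_H(n_H,q)$: set $n_H\leftarrow n_E$, let $q_{new}$ be the Euclidean center of the Euclidean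 ball equal to $\mathcal{B}_H(q,d_H(q,n_H))$, and set $n_E\leftarrow\mathcal{O}(q_{new},\mathcal{D})$; finally return $n_H$. *)

theory Defs
  imports "HOL-Analysis.Analysis" "HOL-Library.While_Combinator"
begin

abbreviation poincare_ball :: "(real^'r) set" where
  "poincare_ball \<equiv> ball 0 1"

definition hyp_dist :: "real^'r \<Rightarrow> real^'r \<Rightarrow> real" where
  "hyp_dist x y =
     arcosh (1 + 2 * (norm (x - y))\<^sup>2 / ((1 - (norm x)\<^sup>2) * (1 - (norm y)\<^sup>2)))"

definition hyp_ball :: "real^'r \<Rightarrow> real \<Rightarrow> (real^'r) set" where
  "hyp_ball q d = {x \<in> poincare_ball. hyp_dist q x \<le> d}"

text \<open>The description is meaningful only for sets that are nonempty closed Euclidean balls; these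
  include all sets \<open>hyp_ball q d\<close> with \<open>q\<close> in the Poincare ball and \<open>0 \<le> d\<close>.\<close>

definition euclidean_center :: "(real^'r) set \<Rightarrow> real^'r" where
  "euclidean_center B = (THE c. \<exists>\<rho>\<ge>0. B = cball c \<rho>)"

definition euclidean_nearest :: "real^'r \<Rightarrow> (real^'r) set \<Rightarrow> real^'r \<Rightarrow> bool" where
  "euclidean_nearest q D p \<longleftrightarrow> p \<in> D \<and> (\<forall>x\<in>D. dist q p \<le> dist q x)"

definition hyp_nearest :: "real^'r \<Rightarrow> (real^'r) set \<Rightarrow> real^'r \<Rightarrow> bool" where
  "hyp_nearest q D p \<longleftrightarrow> p \<in> D \<and> (\<forall>x\<in>D. hyp_dist q p \<le> hyp_dist q x)"

text \<open>Points at equal distance may be listed in any order, so a point that is tied with others is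
  a \<open>k\<close>-th nearest neighbor for several values of \<open>k\<close>.  Ranks start at 1.\<close>

definition kth_hyp_nearest :: "nat \<Rightarrow> real^'r \<Rightarrow> (real^'r) set \<Rightarrow> real^'r \<Rightarrow> bool" where
  "kth_hyp_nearest k q D p \<longleftrightarrow>
     (\<exists>xs. distinct xs \<and> set xs = D \<and> sorted (map (hyp_dist q) xs) \<and>
           1 \<le> k \<and> k \<le> length xs \<and> xs ! (k - 1) = p)"

text \<open>\<open>query_time\<close> is the cost of one query; \<open>store_size\<close> is the space taken by the structure that
  holds a dataset, which is kept between queries.\<close>

record 'p nn_oracle =
  answer :: "'p \<Rightarrow> 'p set \<Rightarrow> 'p"
  query_time :: "'p \<Rightarrow> 'p set \<Rightarrow> real"
  store_size :: "'p set \<Rightarrow> real"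

definition exact_nn_oracle ::
    "(real^'r) nn_oracle \<Rightarrow> (real^'r) set \<Rightarrow> real \<Rightarrow> real \<Rightarrow> bool" where
  "exact_nn_oracle orc D T S \<longleftrightarrow>
     (\<forall>x. euclidean_nearest x D (answer orc x D)) \<and>
     (\<forall>x. 0 \<le> query_time orc x D \<and> query_time orc x D \<le> T) \<and>
     store_size orc D = S"

text \<open>Program state with cost accounting.  Only the oracle is charged: each invocation adds its
  query time, and the structure of a dataset is charged once, however often it is queried.\<close>

record 'p run_state =
  n_H :: 'p
  n_E :: 'p
  calls :: nat
  runtime :: real
  structures :: "'p set set"

definition storage :: "'p nn_oracle \<Rightarrow> 'p run_state \<Rightarrow> real" where
  "storage orc s = (\<Sum>A\<in>structures s. store_size orc A)"

definition invoke :: "'p nn_oracle \<Rightarrow> 'p \<Rightarrow> 'p set \<Rightarrow> 'p run_state \<Rightarrow> 'p run_state" where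
  "invoke orc x D s =
     s\<lparr>n_E := answer orc x D,
       calls := Suc (calls s),
       runtime := runtime s + query_time orc x D,
       structures := insert D (structures s)\<rparr>"

text \<open>The first value of \<open>n_E\<close> below is a placeholder that \<open>invoke\<close> overwrites.\<close>

definition recentering_init ::
    "(real^'r) nn_oracle \<Rightarrow> (real^'r) set \<Rightarrow> real^'r \<Rightarrow> (real^'r) run_state" where
  "recentering_init orc D q =
     invoke orc q D \<lparr>n_H = q, n_E = q, calls = 0, runtime = 0, structures = {}\<rparr>"

definition recentering_step ::
    "(real^'r) nn_oracle \<Rightarrow> (real^'r) set \<Rightarrow> real^'r \<Rightarrow> (real^'r) run_state \<Rightarrow> (real^'r) run_state" where
  "recentering_step orc D q s =
     (let s' = s\<lparr>n_H := n_E s\<rparr>;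
          q_new = euclidean_center (hyp_ball q (hyp_dist q (n_H s')))
      in invoke orc q_new D s')"

text \<open>The result is \<open>None\<close> if the loop does not terminate, and otherwise the final state, whose
  \<open>n_H\<close> is the returned point.\<close>

definition recentering_hyperbolic_nn ::
    "(real^'r) nn_oracle \<Rightarrow> (real^'r) set \<Rightarrow> real^'r \<Rightarrow> (real^'r) run_state option" where
  "recentering_hyperbolic_nn orc D q =
     while_option (\<lambda>s. hyp_dist (n_E s) q \<noteq> hyp_dist (n_H s) q)
       (recentering_step orc D q) (recentering_init orc D q)"

end

theory Submission
  imports Defs
begin

text \<open>Put \<open>s = \<parallel>q - p\<parallel>\<^sup>2 / (1 - \<parallel>p\<parallel>\<^sup>2)\<close>.  Completing the square in \<open>\<parallel>q - x\<parallel>\<^sup>2 - s (1 - \<parallel>x\<parallel>\<^sup>2)\<close> shows that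
  the hyperbolic ball about \<open>q\<close> through \<open>p\<close> is the Euclidean ball about \<open>q / (1 + s)\<close> through \<open>p\<close>, with
  matching interiors.  So the Euclidean nearest neighbor of that center is hyperbolically strictly
  closer to \<open>q\<close> than \<open>p\<close>, unless \<open>p\<close> is already a hyperbolic nearest neighbor.  Hence the number of
  data points strictly closer to \<open>q\<close> than the current candidate, at first at most \<open>k - 1\<close>, drops with
  each iteration but the last.\<close>

section \<open>Hyperbolic balls as Euclidean balls\<close>

lemma hyp_dist_commute: "hyp_dist x y = hyp_dist y x"
  by (simp add: hyp_dist_def norm_minus_commute mult.commute)

text \<open>For \<open>q\<close> and \<open>x\<close> in the ball, \<open>hyp_dist q x\<close> is a
  strictly increasing function of this quotient once \<open>q\<close> is fixed, so distances to
  \<open>q\<close> can be compared without \<open>arcosh\<close>.\<close>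

definition dist_ratio :: "real^'r \<Rightarrow> real^'r \<Rightarrow> real" where
  "dist_ratio q x = (norm (q - x))\<^sup>2 / (1 - (norm x)\<^sup>2)"

lemma one_minus_norm_square_pos:
  fixes x :: "'a::real_normed_vector"
  assumes "x \<in> ball 0 1"
  shows "0 < 1 - (norm x)\<^sup>2"
  using assms by (simp add: power_less_one_iff abs_square_less_1)

lemma dist_ratio_nonneg:
  assumes "x \<in> poincare_ball"
  shows "0 \<le> dist_ratio q x"
  using one_minus_norm_square_pos[OF assms] by (simp add: dist_ratio_def)

lemma dist_ratio_eq_0_iff:
  assumes "x \<in> poincare_ball"
  shows "dist_ratio q x = 0 \<longleftrightarrow> x = q"
  using one_minus_norm_square_pos[OF assms] by (auto simp: dist_ratio_def)

lemma hyp_dist_less_iff: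
  assumes q: "q \<in> poincare_ball" and x: "x \<in> poincare_ball" and y: "y \<in> poincare_ball"
  shows "hyp_dist q x < hyp_dist q y \<longleftrightarrow> dist_ratio q x < dist_ratio q y"
proof -
  define c where "c = 2 / (1 - (norm q)\<^sup>2)"
  have c: "c > 0"
    using one_minus_norm_square_pos[OF q] by (simp add: c_def)
  have eq: "hyp_dist q z = arcosh (1 + c * dist_ratio q z)" for z
    by (simp add: hyp_dist_def dist_ratio_def c_def)
  have "0 \<le> c * dist_ratio q x" "0 \<le> c * dist_ratio q y"
    using c dist_ratio_nonneg[OF x, of q] dist_ratio_nonneg[OF y, of q] by simp_all
  then show ?thesis
    using c by (simp add: eq arcosh_less_iff_real)
qed

lemma hyp_dist_le_iff:
  assumes "q \<in> poincare_ball" "x \<in> poincare_ball" "y \<in> poincare_ball"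
  shows "hyp_dist q x \<le> hyp_dist q y \<longleftrightarrow> dist_ratio q x \<le> dist_ratio q y"
  using hyp_dist_less_iff[OF assms(1,3,2)] by (simp add: linorder_not_less[symmetric])

text \<open>In the unit ball the sign of the left side compares \<open>dist_ratio q x\<close> with
  \<open>s\<close>; the right side turns this into a comparison with a Euclidean sphere centered at
  \<open>q\<close> scaled by \<open>1 / (1 + s)\<close>.\<close>

lemma complete_square_ratio:
  fixes q x :: "'a::real_inner"
  assumes "s \<ge> 0"
  shows "(norm (q - x))\<^sup>2 - s * (1 - (norm x)\<^sup>2)
    = (1 + s) * ((dist (q /\<^sub>R (1 + s)) x)\<^sup>2 - s * (1 + s - (norm q)\<^sup>2) / (1 + s)\<^sup>2)"
proof -
  define t where "t = 1 + s"
  have t: "t > 0" and s: "s = t - 1"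
    using assms by (auto simp: t_def)
  have dist: "(dist (q /\<^sub>R t) x)\<^sup>2 = (norm q)\<^sup>2 / t\<^sup>2 - 2 * (q \<bullet> x) / t + (norm x)\<^sup>2"
    using t unfolding dist_norm power2_norm_eq_inner
    by (simp add: inner_diff inner_commute power2_eq_square divide_simps) (simp add: algebra_simps)
  have norm: "(norm (q - x))\<^sup>2 = (norm q)\<^sup>2 - 2 * (q \<bullet> x) + (norm x)\<^sup>2"
    unfolding power2_norm_eq_inner by (simp add: inner_diff inner_commute)
  show ?thesis
    unfolding t_def[symmetric] dist norm unfolding s using t
    by (simp add: field_simps power2_eq_square)
qed

text \<open>The strict comparison is kept separately because the loop has to tell interior points,
  which mean progress, from boundary points.\<close>

lemma hyp_ball_through_point:
  assumes q: "q \<in> poincare_ball" and p: "p \<in> poincare_ball"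
  defines "c \<equiv> q /\<^sub>R (1 + dist_ratio q p)"
  shows "hyp_ball q (hyp_dist q p) = cball c (dist c p)"
    and "\<And>x. x \<in> poincare_ball \<Longrightarrow> hyp_dist q x < hyp_dist q p \<longleftrightarrow> dist c x < dist c p"
proof -
  define s where "s = dist_ratio q p"
  have s: "s \<ge> 0"
    unfolding s_def by (rule dist_ratio_nonneg[OF p])
  define R where "R = s * (1 + s - (norm q)\<^sup>2) / (1 + s)\<^sup>2"
  have square: "(norm (q - x))\<^sup>2 - s * (1 - (norm x)\<^sup>2) = (1 + s) * ((dist c x)\<^sup>2 - R)" for x
    using complete_square_ratio[OF s, of q x] by (simp add: c_def s_def R_def)
  \<comment> \<open>By the choice of \<open>s\<close> both sides of \<open>square\<close> vanish at
    \<open>p\<close>, which identifies \<open>R\<close> as the squared radius.\<close>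
  have "(norm (q - p))\<^sup>2 - s * (1 - (norm p)\<^sup>2) = 0"
    using one_minus_norm_square_pos[OF p] by (simp add: s_def dist_ratio_def)
  with square[of p] s have R: "R = (dist c p)\<^sup>2"
    by auto
  have less: "dist c x < dist c p \<longleftrightarrow> (norm (q - x))\<^sup>2 < s * (1 - (norm x)\<^sup>2)" for x
  proof -
    have "dist c x < dist c p \<longleftrightarrow> (dist c x)\<^sup>2 < (dist c p)\<^sup>2"
      by (simp add: abs_le_square_iff linorder_not_le[symmetric] power2_le_iff_abs_le)
    also have "\<dots> \<longleftrightarrow> (1 + s) * ((dist c x)\<^sup>2 - R) < 0"
      using s by (simp add: R mult_less_0_iff)
    finally show ?thesis
      by (simp flip: square)
  qed
  have le: "dist c x \<le> dist c p \<longleftrightarrow> (norm (q - x))\<^sup>2 \<le> s * (1 - (norm x)\<^sup>2)" for x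
  proof -
    have "dist c x \<le> dist c p \<longleftrightarrow> (dist c x)\<^sup>2 \<le> (dist c p)\<^sup>2"
      by (simp add: power2_le_iff_abs_le)
    also have "\<dots> \<longleftrightarrow> (1 + s) * ((dist c x)\<^sup>2 - R) \<le> 0"
      using s by (simp add: R mult_le_0_iff)
    finally show ?thesis
      by (simp flip: square)
  qed
  show "hyp_dist q x < hyp_dist q p \<longleftrightarrow> dist c x < dist c p" if "x \<in> poincare_ball" for x
    using one_minus_norm_square_pos[OF that]
    by (simp add: hyp_dist_less_iff[OF q that p] less s_def dist_ratio_def[of q x] divide_less_eq)
  have le_iff: "hyp_dist q x \<le> hyp_dist q p \<longleftrightarrow> dist c x \<le> dist c p" if "x \<in> poincare_ball" for x
    using one_minus_norm_square_pos[OF that]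
    by (simp add: hyp_dist_le_iff[OF q that p] le s_def dist_ratio_def[of q x] divide_le_eq)
  \<comment> \<open>The Euclidean ball must not leave the unit ball: at a point outside,
    \<open>le\<close> would force \<open>x = q\<close>.\<close>
  have "x \<in> poincare_ball" if "dist c x \<le> dist c p" for x
  proof (rule ccontr)
    assume x: "x \<notin> poincare_ball"
    then have "s * (1 - (norm x)\<^sup>2) \<le> 0"
      using s by (intro mult_nonneg_nonpos) (auto simp: one_le_power)
    then have "(norm (q - x))\<^sup>2 \<le> 0"
      using that le[of x] by linarith
    with q x show False
      by simp
  qed
  then show "hyp_ball q (hyp_dist q p) = cball c (dist c p)"
    using le_iff by (auto simp: hyp_ball_def simp del: mem_ball)
qed

text \<open>Radius 0 is included because the ball through \<open>p\<close> degenerates to a point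
  when \<open>p = q\<close>.\<close>

lemma euclidean_center_cball:
  assumes "0 \<le> \<rho>"
  shows "euclidean_center (cball c \<rho>) = c"
  unfolding euclidean_center_def
  using assms by (intro the_equality) (auto simp: cball_eq_cball_iff)

text \<open>As \<open>p\<close> is on the boundary of the recentered ball, \<open>e\<close> cannot
  lie outside it. If \<open>e\<close> is not interior, then no data point is, so none is strictly
  closer to \<open>q\<close> than \<open>p\<close>.\<close>

lemma recentered_nearest:
  assumes D: "D \<subseteq> poincare_ball" and q: "q \<in> poincare_ball" and p: "p \<in> D"
    and e: "euclidean_nearest (euclidean_center (hyp_ball q (hyp_dist q p))) D e"
  shows "hyp_dist q e < hyp_dist q p \<or> hyp_dist q e = hyp_dist q p \<and> hyp_nearest q D p"
proof -
  have p': "p \<in> poincare_ball"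
    using D p by blast
  define c where "c = q /\<^sub>R (1 + dist_ratio q p)"
  note ball = hyp_ball_through_point[OF q p', folded c_def]
  have center: "euclidean_center (hyp_ball q (hyp_dist q p)) = c"
    by (simp add: ball(1) euclidean_center_cball)
  have eD: "e \<in> D" and min: "\<And>x. x \<in> D \<Longrightarrow> dist c e \<le> dist c x"
    using e by (auto simp: euclidean_nearest_def center)
  have "e \<in> hyp_ball q (hyp_dist q p)"
    using min[OF p] by (simp add: ball(1))
  then have le: "hyp_dist q e \<le> hyp_dist q p"
    by (simp add: hyp_ball_def)
  show ?thesis
  proof (cases "hyp_dist q e < hyp_dist q p")
    case False
    have "hyp_dist q p \<le> hyp_dist q x" if x: "x \<in> D" for x
    proof (rule ccontr)
      assume "\<not> hyp_dist q p \<le> hyp_dist q x"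
      then have "dist c x < dist c p"
        using ball(2)[of x] D x by auto
      then have "dist c e < dist c p"
        using min[OF x] by linarith
      with False show False
        using ball(2)[of e] D eD by auto
    qed
    with False le p show ?thesis
      by (auto simp: hyp_nearest_def)
  qed simp
qed

section \<open>Progress of the loop\<close>

text \<open>Termination measure of the loop. Strictness makes it independent of the order in which
  ties are listed.\<close>

definition num_closer :: "real^'r \<Rightarrow> (real^'r) set \<Rightarrow> real^'r \<Rightarrow> nat" where
  "num_closer q D p = card {x \<in> D. hyp_dist q x < hyp_dist q p}"

lemma num_closer_less:
  assumes "finite D" "e \<in> D" "hyp_dist q e < hyp_dist q p"
  shows "num_closer q D e < num_closer q D p"
  unfolding num_closer_def using assms by (intro psubset_card_mono) auto

text \<open>In the sorted list, all strictly closer points come before index \<open>k - 1\<close>,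
  the zero-based position of \<open>p\<close>.\<close>

lemma num_closer_less_rank:
  assumes "kth_hyp_nearest k q D p"
  shows "num_closer q D p < k"
proof -
  obtain xs where xs: "set xs = D" "sorted (map (hyp_dist q) xs)"
      "1 \<le> k" "k \<le> length xs" "xs ! (k - 1) = p"
    using assms by (auto simp: kth_hyp_nearest_def)
  have "{x \<in> D. hyp_dist q x < hyp_dist q p} \<subseteq> set (take (k - 1) xs)"
  proof
    fix x
    assume "x \<in> {x \<in> D. hyp_dist q x < hyp_dist q p}"
    then obtain i where i: "i < length xs" "xs ! i = x" "hyp_dist q x < hyp_dist q p"
      using xs(1) by (auto simp: in_set_conv_nth)
    have "i < k - 1"
    proof (rule ccontr)
      assume "\<not> i < k - 1"
      then have "map (hyp_dist q) xs ! (k - 1) \<le> map (hyp_dist q) xs ! i"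
        using i xs by (intro sorted_nth_mono) auto
      then show False
        using i xs by auto
    qed
    then show "x \<in> set (take (k - 1) xs)"
      using i by (auto simp: in_set_conv_nth intro!: exI[of _ i])
  qed
  then have "num_closer q D p \<le> card (set (take (k - 1) xs))"
    unfolding num_closer_def by (intro card_mono) auto
  also have "\<dots> \<le> k - 1"
    using card_length[of "take (k - 1) xs"] by simp
  finally show ?thesis
    using xs(3) by simp
qed

text \<open>The last conjunct is vacuous while the loop guard holds and gives correctness on
  exit.\<close>

definition recentering_inv ::
    "(real^'r) nn_oracle \<Rightarrow> (real^'r) set \<Rightarrow> real^'r \<Rightarrow> real \<Rightarrow> (real^'r) run_state \<Rightarrow> bool" where
  "recentering_inv orc D q T s \<longleftrightarrow>
     n_E s \<in> D \<and> structures s = {D} \<and> runtime s \<le> real (calls s) * T \<and>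
     (hyp_dist (n_E s) q = hyp_dist (n_H s) q \<longrightarrow> hyp_nearest q D (n_H s))"

lemma recentering_inv_init:
  assumes D: "D \<subseteq> poincare_ball" and q: "q \<in> poincare_ball" and orc: "exact_nn_oracle orc D T S"
  shows "recentering_inv orc D q T (recentering_init orc D q)"
proof -
  have e: "answer orc q D \<in> D" and t: "query_time orc q D \<le> T"
    using orc by (auto simp: exact_nn_oracle_def euclidean_nearest_def)
  \<comment> \<open>At the start \<open>n_H\<close> is \<open>q\<close>, which need not be in
    \<open>D\<close>. An immediate exit forces the oracle to have answered \<open>q\<close>
    itself.\<close>
  have "hyp_nearest q D q" if eq: "hyp_dist (answer orc q D) q = hyp_dist q q"
  proof -
    have e': "answer orc q D \<in> poincare_ball"
      using D e by blast
    have "dist_ratio q (answer orc q D) \<le> dist_ratio q q"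
      using eq hyp_dist_le_iff[OF q e' q] by (simp add: hyp_dist_commute)
    then have "dist_ratio q (answer orc q D) = 0"
      using dist_ratio_nonneg[OF e', of q] by (simp add: dist_ratio_def)
    then have "q \<in> D"
      using dist_ratio_eq_0_iff[OF e', of q] e by simp
    moreover have "hyp_dist q q \<le> hyp_dist q x" if "x \<in> D" for x
    proof -
      have x: "x \<in> poincare_ball"
        using D that by blast
      have "dist_ratio q q = 0"
        by (simp add: dist_ratio_def)
      then show ?thesis
        using hyp_dist_le_iff[OF q q x] dist_ratio_nonneg[OF x, of q] by simp
    qed
    ultimately show ?thesis
      by (simp add: hyp_nearest_def)
  qed
  with e t show ?thesis
    by (simp add: recentering_inv_def recentering_init_def invoke_def)
qed

lemma recentering_step_progress:
  fixes s :: "(real^'r) run_state"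
  assumes D: "D \<subseteq> poincare_ball" and q: "q \<in> poincare_ball" and orc: "exact_nn_oracle orc D T S"
    and inv: "recentering_inv orc D q T s"
  defines "s' \<equiv> recentering_step orc D q s"
  shows "recentering_inv orc D q T s'"
    and "calls s' = Suc (calls s)"
    and "n_H s' = n_E s"
    and "hyp_dist q (n_E s') \<le> hyp_dist q (n_E s)"
proof -
  define c where "c = euclidean_center (hyp_ball q (hyp_dist q (n_E s)))"
  have s': "s' = invoke orc c D (s\<lparr>n_H := n_E s\<rparr>)"
    by (simp add: s'_def recentering_step_def c_def)
  have e: "euclidean_nearest c D (answer orc c D)" and t: "query_time orc c D \<le> T"
    using orc by (auto simp: exact_nn_oracle_def)
  have pD: "n_E s \<in> D"
    using inv by (simp add: recentering_inv_def)
  \<comment> \<open>The old \<open>n_E\<close> becomes \<open>n_H\<close>, so the equality case is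
    exactly what the exit conjunct of the invariant demands.\<close>
  note progress = recentered_nearest[OF D q pD e[unfolded c_def], folded c_def]
  show "calls s' = Suc (calls s)" "n_H s' = n_E s"
    by (simp_all add: s' invoke_def)
  show "hyp_dist q (n_E s') \<le> hyp_dist q (n_E s)"
    using progress by (auto simp: s' invoke_def)
  have "answer orc c D \<in> D"
    using e by (simp add: euclidean_nearest_def)
  moreover have "runtime s + query_time orc c D \<le> real (Suc (calls s)) * T"
    using inv t by (simp add: recentering_inv_def algebra_simps)
  ultimately show "recentering_inv orc D q T s'"
    using progress inv by (auto simp: recentering_inv_def s' invoke_def hyp_dist_commute[of _ q])
qed

text \<open>Each iteration that leaves the guard true lowers the measure; the extra 1 pays for the
  call that finds no improvement.\<close>

lemma recentering_loop_terminates: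
  fixes s :: "(real^'r) run_state"
  assumes D: "finite D" "D \<subseteq> poincare_ball" and q: "q \<in> poincare_ball"
    and orc: "exact_nn_oracle orc D T S"
    and inv: "recentering_inv orc D q T s"
  shows "\<exists>s'. while_option (\<lambda>s. hyp_dist (n_E s) q \<noteq> hyp_dist (n_H s) q)
                (recentering_step orc D q) s = Some s' \<and>
              recentering_inv orc D q T s' \<and> hyp_dist (n_E s') q = hyp_dist (n_H s') q \<and>
              calls s' \<le> calls s + num_closer q D (n_E s) + 1"
  using inv
proof (induction "num_closer q D (n_E s)" arbitrary: s rule: less_induct)
  case less
  let ?b = "\<lambda>s. hyp_dist (n_E s) q \<noteq> hyp_dist (n_H s) q"
  let ?s = "recentering_step orc D q s"
  note step = recentering_step_progress[OF D(2) q orc less.prems]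
  show ?case
  proof (cases "?b s")
    case False
    with less.prems show ?thesis
      by (subst while_option_unfold) auto
  next
    case True
    show ?thesis
    proof (cases "?b ?s")
      case False
      \<comment> \<open>The first unfolding runs the body, the second meets the false guard.\<close>
      with True step show ?thesis
        by (subst while_option_unfold, subst while_option_unfold) auto
    next
      case b: True
      then have "hyp_dist q (n_E ?s) < hyp_dist q (n_E s)"
        using step(3,4) by (simp add: hyp_dist_commute[of _ q])
      then have closer: "num_closer q D (n_E ?s) < num_closer q D (n_E s)"
        using D(1) step(1) by (intro num_closer_less) (auto simp: recentering_inv_def)
      from less.hyps[OF closer step(1)] closer step(2) True show ?thesis
        by (subst while_option_unfold) auto
    qed
  qed
qed

theorem theorem1:
  fixes D :: "(real^'r) set" and q :: "real^'r"
    and orc :: "(real^'r) nn_oracle" and T S :: real and k :: nat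
  assumes "finite D" and "D \<subseteq> poincare_ball"
    and "q \<in> poincare_ball"
    and "exact_nn_oracle orc D T S"
    and "kth_hyp_nearest k q D (answer orc q D)"
  shows "\<exists>s. recentering_hyperbolic_nn orc D q = Some s \<and>
             hyp_nearest q D (n_H s) \<and>
             calls s \<le> k + 1 \<and>
             runtime s \<le> real (k + 1) * T \<and>
             storage orc s = S"
proof -
  let ?s0 = "recentering_init orc D q"
  have s0: "calls ?s0 = 1" "n_E ?s0 = answer orc q D"
    by (simp_all add: recentering_init_def invoke_def)
  obtain s where s: "recentering_hyperbolic_nn orc D q = Some s"
      and inv: "recentering_inv orc D q T s" and eq: "hyp_dist (n_E s) q = hyp_dist (n_H s) q"
      and calls: "calls s \<le> calls ?s0 + num_closer q D (n_E ?s0) + 1"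
    using recentering_loop_terminates[OF assms(1-4) recentering_inv_init[OF assms(2-4)]]
    unfolding recentering_hyperbolic_nn_def by blast
  \<comment> \<open>One initial call, at most \<open>k - 1\<close> improving ones and a final
    one.\<close>
  have k: "calls s \<le> k + 1"
    using calls num_closer_less_rank[OF assms(5)] by (simp add: s0)
  \<comment> \<open>Query times lie between 0 and \<open>T\<close>, so \<open>T\<close> is
    nonnegative and the bound on calls carries over to the runtime.\<close>
  have "0 \<le> T" and S: "store_size orc D = S"
    using assms(4) by (auto simp: exact_nn_oracle_def intro: order_trans)
  then have "real (calls s) * T \<le> real (k + 1) * T"
    using k by (intro mult_right_mono) simp_all
  with inv have "runtime s \<le> real (k + 1) * T"
    by (simp add: recentering_inv_def)
  with s inv eq k S show ?thesis
    by (auto simp: recentering_inv_def storage_def)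
qed

end
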